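(* Let $x$ be an input with ground-truth answer $y$, let $\hat y$ be any answer, and let $n\ge 1$. Let $\tilde t_1,\dots,\tilde t_n$ be sampled independently from $p(\cdot\,|\,x)$, let $\tilde y_i=g(\tilde t_i)$, and let $$\hat p^{(\mathrm{SC})}(\hat y\,|\,x)=\frac1n\sum_{i=1}^n \mathbb I[\tilde y_i=\hat y].$$ Then the reasoning error $$\mathcal E(\hat p^{(\mathrm{SC})})=\mathbb E_{\tilde t_1,\dots,\tilde t_n\sim p(\cdot|x)}\Big[\big(\hat p^{(\mathrm{SC})}(\hat y\,|\,x)-\mathbb I[\hat y=y]\big)^2\Big]$$ decomposes as $$\mathcal E(\hat p^{(\mathrm{SC})})=\underbrace{\frac1n\,p(\hat y\,|\,x)\,\big(1-p(\hat y\,|\,x)\big)}_{\text{Estimation Error}}+\underbrace{\big(p(\hat y\,|\,x)-\mathbb I[\hat y=y]\big)^2}_{\text{Model Error}}.$$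
   Context: A reasoning path is a finite sequence of tokens (from a finite vocabulary), so the set of reasoning paths is countable. For a fixed input $x$, the language model defines a probability distribution $p(t\,|\,x)$ on reasoning paths $t$. A deterministic answer extraction function $g$ maps each reasoning path to an answer. The probability of an answer $\hat y$ is the induced one: $p(\hat y\,|\,x)=\sum_{t:\,g(t)=\hat y}p(t\,|\,x)$. $\mathbb I[\cdot]$ is the indicator ($1$ if the condition holds, $0$ otherwise). SC stands for "self-consistency". *)

theory Defs
  imports "HOL-Probability.Probability"
begin

text \<open>
  A reasoning path is a list over a finite vocabulary \<open>'v\<close>. A language model assigns to every
  input a probability mass function on reasoning paths; \<open>g\<close> extracts the answer of a path.
\<close>

type_synonym 'v path = "'v list"

type_synonym ('x, 'v) language_model = "'x \<Rightarrow> 'v path pmf"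

definition answer_prob ::
  "('x, 'v::finite) language_model \<Rightarrow> ('v path \<Rightarrow> 'a) \<Rightarrow> 'x \<Rightarrow> 'a \<Rightarrow> real" where
  "answer_prob p g x a = (\<Sum>\<^sub>\<infinity>t\<in>{t. g t = a}. pmf (p x) t)"

text \<open>
  The i.i.d. samples are random variables \<open>T 1, \<dots>, T n\<close> on an arbitrary probability space \<open>M\<close>,
  jointly independent, each with law \<open>p x\<close>. The values of \<open>T\<close> outside \<open>{1..n}\<close> are irrelevant.
\<close>

definition iid_samples ::
  "'w measure \<Rightarrow> ('x, 'v::finite) language_model \<Rightarrow> 'x \<Rightarrow> nat \<Rightarrow> (nat \<Rightarrow> 'w \<Rightarrow> 'v path) \<Rightarrow> bool" where
  "iid_samples M p x n T \<longleftrightarrow>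
     prob_space.indep_vars M (\<lambda>_. count_space UNIV) T {1..n} \<and>
     (\<forall>i\<in>{1..n}. distr M (count_space UNIV) (T i) = measure_pmf (p x))"

definition sc_estimate :: "('v::finite path \<Rightarrow> 'a) \<Rightarrow> nat \<Rightarrow> (nat \<Rightarrow> 'v path) \<Rightarrow> 'a \<Rightarrow> real" where
  "sc_estimate g n ts a = 1 / real n * (\<Sum>i=1..n. of_bool (g (ts i) = a))"

text \<open>Here \<open>q \<omega>\<close> is the (random) estimated distribution on answers and \<open>y\<close> the ground truth.\<close>

definition reasoning_error :: "'w measure \<Rightarrow> ('w \<Rightarrow> 'a \<Rightarrow> real) \<Rightarrow> 'a \<Rightarrow> 'a \<Rightarrow> real" where
  "reasoning_error M q a y = (LINT \<omega>|M. (q \<omega> a - of_bool (a = y))\<^sup>2)"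

end

theory Submission
  imports Defs
begin

text \<open>This is a bias-variance decomposition. With \<open>q\<close> the model probability of
  \<open>yhat\<close>, the deviation of the estimate from the truth indicator splits as
  \<open>S / n + d\<close>: \<open>S\<close> sums the centered indicators \<open>Z i\<close>, and
  \<open>d\<close>, the gap between \<open>q\<close> and the truth indicator, is constant. Squaring
  and taking expectations kills the cross term, since \<open>S\<close> has mean 0. By
  \<open>second_moment_sum_indep_centered\<close> the second moment of \<open>S\<close> is additive
  over the independent \<open>Z i\<close>, each contributing the Bernoulli variance
  \<open>q * (1 - q)\<close>. Each indicator has mean \<open>q\<close> because
  \<open>answer_prob_eq_measure\<close> reads the infinite sum as the probability of a fibre of
  \<open>g\<close>.\<close>

lemma answer_prob_eq_measure:
  "answer_prob p g x a = measure (measure_pmf (p x)) {t. g t = a}"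
  by (simp add: answer_prob_def measure_pmf_conv_infsetsum infsetsum_infsum pmf_abs_summable)

text \<open>Expanding the square gives a double sum; off the diagonal, independence factors each
  expectation into a product of means, which is 0. Integrability is part of the conclusion because
  later uses of linearity need it.\<close>

lemma (in prob_space) second_moment_sum_indep_centered:
  fixes Z :: "'i \<Rightarrow> 'a \<Rightarrow> real"
  assumes fin: "finite I"
    and indep: "indep_vars (\<lambda>_. borel) Z I"
    and int: "\<And>i. i \<in> I \<Longrightarrow> integrable M (Z i)"
    and int2: "\<And>i. i \<in> I \<Longrightarrow> integrable M (\<lambda>\<omega>. (Z i \<omega>)\<^sup>2)"
    and centered: "\<And>i. i \<in> I \<Longrightarrow> expectation (Z i) = 0"
  shows "expectation (\<lambda>\<omega>. (\<Sum>i\<in>I. Z i \<omega>)\<^sup>2) = (\<Sum>i\<in>I. expectation (\<lambda>\<omega>. (Z i \<omega>)\<^sup>2))"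
    and "integrable M (\<lambda>\<omega>. (\<Sum>i\<in>I. Z i \<omega>)\<^sup>2)"
proof -
  have cross: "integrable M (\<lambda>\<omega>. Z i \<omega> * Z j \<omega>) \<and>
      expectation (\<lambda>\<omega>. Z i \<omega> * Z j \<omega>) = (if i = j then expectation (\<lambda>\<omega>. (Z i \<omega>)\<^sup>2) else 0)"
    if "i \<in> I" "j \<in> I" for i j
  proof (cases "i = j")
    case True
    then show ?thesis using int2[of i] that by (simp add: power2_eq_square)
  next
    case False
    \<comment> \<open>The product formula for independent families is applied to the index set
      \<open>{i, j}\<close>; as \<open>i \<noteq> j\<close>, the product over this set is
      \<open>Z i \<omega> * Z j \<omega>\<close>.\<close>
    have ind: "indep_vars (\<lambda>_. borel) Z {i, j}"
      using indep that by (auto intro: indep_vars_subset)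
    have "integrable M (Z k)" if "k \<in> {i, j}" for k
      using that int \<open>i \<in> I\<close> \<open>j \<in> I\<close> by auto
    then show ?thesis
      using indep_vars_lebesgue_integral[OF _ ind] indep_vars_integrable[OF _ ind]
        False centered that by simp
  qed
  have expand: "(\<Sum>i\<in>I. Z i \<omega>)\<^sup>2 = (\<Sum>i\<in>I. \<Sum>j\<in>I. Z i \<omega> * Z j \<omega>)" for \<omega>
    by (simp add: power2_eq_square sum_product)
  show "integrable M (\<lambda>\<omega>. (\<Sum>i\<in>I. Z i \<omega>)\<^sup>2)"
    using cross by (auto simp: expand intro!: Bochner_Integration.integrable_sum)
  have "expectation (\<lambda>\<omega>. (\<Sum>i\<in>I. Z i \<omega>)\<^sup>2) = (\<Sum>i\<in>I. \<Sum>j\<in>I. expectation (\<lambda>\<omega>. Z i \<omega> * Z j \<omega>))"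
    using cross by (simp add: expand Bochner_Integration.integral_sum)
  also have "\<dots> = (\<Sum>i\<in>I. \<Sum>j\<in>I. if i = j then expectation (\<lambda>\<omega>. (Z i \<omega>)\<^sup>2) else 0)"
    using cross by (intro sum.cong) auto
  finally show "expectation (\<lambda>\<omega>. (\<Sum>i\<in>I. Z i \<omega>)\<^sup>2) = (\<Sum>i\<in>I. expectation (\<lambda>\<omega>. (Z i \<omega>)\<^sup>2))"
    using fin by simp
qed

theorem proposition1:
  fixes M :: "'w measure"
    and p :: "('x, 'v::finite) language_model"
    and g :: "'v path \<Rightarrow> 'a"
    and x :: 'x and y yhat :: 'a and n :: nat
    and T :: "nat \<Rightarrow> 'w \<Rightarrow> 'v path"
  assumes "prob_space M"
    and "n \<ge> 1"
    and "iid_samples M p x n T"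
  shows "reasoning_error M (\<lambda>\<omega>. sc_estimate g n (\<lambda>i. T i \<omega>)) yhat y =
           1 / real n * answer_prob p g x yhat * (1 - answer_prob p g x yhat)
           + (answer_prob p g x yhat - of_bool (yhat = y))\<^sup>2"
proof -
  interpret prob_space M by fact
  define q where "q = answer_prob p g x yhat"
  define d where "d = q - of_bool (yhat = y)"
  define h :: "'v path \<Rightarrow> real" where "h t = of_bool (g t = yhat)" for t
  define Z where "Z i \<omega> = h (T i \<omega>) - q" for i \<omega>
  define S where "S \<omega> = (\<Sum>i=1..n. Z i \<omega>)" for \<omega>
  have indep: "indep_vars (\<lambda>_. count_space UNIV) T {1..n}"
    using assms(3) by (simp add: iid_samples_def)
  have law: "distr M (count_space UNIV) (T i) = measure_pmf (p x)" if "i \<in> {1..n}" for i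
    using assms(3) that by (simp add: iid_samples_def)
  have rv: "T i \<in> M \<rightarrow>\<^sub>M count_space UNIV" if "i \<in> {1..n}" for i
    using indep that by (auto simp: indep_vars_def)
  have mean: "integrable M (\<lambda>\<omega>. h (T i \<omega>))" "expectation (\<lambda>\<omega>. h (T i \<omega>)) = q"
    if i: "i \<in> {1..n}" for i
  proof -
    have T: "T i \<in> M \<rightarrow>\<^sub>M count_space UNIV" using rv[OF i] .
    show "integrable M (\<lambda>\<omega>. h (T i \<omega>))"
      by (rule integrable_const_bound[where B = 1])
        (auto simp: h_def intro!: measurable_compose[OF T])
    \<comment> \<open>Change of variables: only the law of \<open>T i\<close> matters, so the mean
      can be computed under \<open>p x\<close>.\<close>
    have "expectation (\<lambda>\<omega>. h (T i \<omega>)) = measure_pmf.expectation (p x) h"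
      unfolding law[OF i, symmetric] by (rule integral_distr[symmetric]) (use T in auto)
    also have "\<dots> = measure_pmf.expectation (p x) (indicator {t. g t = yhat})"
      by (intro Bochner_Integration.integral_cong) (auto simp: h_def indicator_def)
    finally show "expectation (\<lambda>\<omega>. h (T i \<omega>)) = q"
      by (simp add: q_def answer_prob_eq_measure)
  qed
  have Z_int: "integrable M (Z i)" and Z_mean: "expectation (Z i) = 0" if "i \<in> {1..n}" for i
    using mean[OF that] by (simp_all add: Z_def[abs_def] prob_space)
  \<comment> \<open>As \<open>h\<close> takes only the values 0 and 1, it equals its own square. The
    square of \<open>Z i\<close> is therefore affine in \<open>h (T i \<omega>)\<close>, and
    \<open>mean\<close> yields both its integrability and its expectation.\<close>
  have Z_sq: "(Z i \<omega>)\<^sup>2 = (1 - 2 * q) * h (T i \<omega>) + q\<^sup>2" for i \<omega>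
    by (simp add: Z_def h_def power2_eq_square algebra_simps)
  have Z_int2: "integrable M (\<lambda>\<omega>. (Z i \<omega>)\<^sup>2)"
    and Z_var: "expectation (\<lambda>\<omega>. (Z i \<omega>)\<^sup>2) = q * (1 - q)" if "i \<in> {1..n}" for i
    unfolding Z_sq
    by (simp add: mean[OF that])
      (simp add: mean[OF that] prob_space, simp add: power2_eq_square algebra_simps)
  \<comment> \<open>Each \<open>Z i\<close> is a function of \<open>T i\<close> alone, so
    independence passes from paths to centered indicators.\<close>
  have "indep_vars (\<lambda>_. borel) Z {1..n}"
    unfolding Z_def[abs_def]
    by (rule indep_vars_compose2[OF indep, where Y = "\<lambda>_ t. h t - q"]) simp
  note S_moment = second_moment_sum_indep_centered[OF _ this Z_int Z_int2 Z_mean]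
  have S_int2: "integrable M (\<lambda>\<omega>. (S \<omega>)\<^sup>2)"
    and S_var: "expectation (\<lambda>\<omega>. (S \<omega>)\<^sup>2) = n * (q * (1 - q))"
    using S_moment by (simp_all add: S_def Z_var)
  have S_int: "integrable M S"
    unfolding S_def[abs_def] by (rule Bochner_Integration.integrable_sum) (rule Z_int)
  have S_mean: "expectation S = 0"
    unfolding S_def[abs_def] by (subst Bochner_Integration.integral_sum) (auto simp: Z_int Z_mean)
  \<comment> \<open>Centering subtracts \<open>q\<close> from each of the \<open>n\<close> summands;
    dividing by \<open>n\<close>, which is nonzero, turns this into a single \<open>q\<close>,
    restored by \<open>d\<close>.\<close>
  have "sc_estimate g n (\<lambda>i. T i \<omega>) yhat - of_bool (yhat = y) = S \<omega> / n + d" for \<omega>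
    using assms(2)
    by (simp add: sc_estimate_def S_def Z_def h_def d_def sum_subtractf diff_divide_distrib)
  then have "reasoning_error M (\<lambda>\<omega>. sc_estimate g n (\<lambda>i. T i \<omega>)) yhat y =
      expectation (\<lambda>\<omega>. (S \<omega>)\<^sup>2 / (real n)\<^sup>2 + 2 * d / n * S \<omega> + d\<^sup>2)"
    by (simp add: reasoning_error_def power2_sum power_divide mult_ac add_ac)
  \<comment> \<open>The cross term is a constant multiple of \<open>S\<close> and vanishes by
    \<open>S_mean\<close>.\<close>
  also have "\<dots> = n * (q * (1 - q)) / (real n)\<^sup>2 + d\<^sup>2"
    using S_int S_int2 by (simp add: S_var S_mean prob_space)
  also have "\<dots> = 1 / n * q * (1 - q) + d\<^sup>2"
    using assms(2) by (simp add: power2_eq_square)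
  finally show ?thesis
    unfolding d_def q_def .
qed

end
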